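(* If $n$ is a power of $2$, then the number of spanning trees of the power graph $\mathcal{P}(Q_{4n})$ is $$\kappa(Q_{4n})=2^{5n-1}\cdot n^{2n-2}.$$
   Context: For a finite group $G$, the power graph $\mathcal{P}(G)$ is the simple undirected graph whose vertices are the elements of $G$, two distinct vertices $x,y$ being adjacent iff $\langle x\rangle\subseteq\langle y\rangle$ or $\langle y\rangle\subseteq\langle x\rangle$. $\kappa(G)$ denotes the number of spanning trees of $\mathcal{P}(G)$. $Q_{4n}=\langle x,y\mid x^{2n}=1,\ y^2=x^n,\ x^y=x^{-1}\rangle$ (with $x^y=y^{-1}xy$) is the generalized quaternion group of order $4n$. *)

theory Defs
  imports "HOL-Algebra.Algebra"
begin

text \<open>The letter \<open>(a, True)\<close> stands for the generator \<open>a\<close> and \<open>(a, False)\<close> for its formal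
  inverse. A relation \<open>u = v\<close> is the pair of words \<open>(u, v)\<close>.\<close>

type_synonym 'g word = "('g \<times> bool) list"

inductive pres_eq :: "('g word \<times> 'g word) set \<Rightarrow> 'g word \<Rightarrow> 'g word \<Rightarrow> bool"
  for R :: "('g word \<times> 'g word) set" where
  relation: "(u, v) \<in> R \<Longrightarrow> pres_eq R u v"
| cancel: "pres_eq R [(a, b), (a, \<not> b)] []"
| refl: "pres_eq R u u"
| sym: "pres_eq R u v \<Longrightarrow> pres_eq R v u"
| trans: "pres_eq R u v \<Longrightarrow> pres_eq R v w \<Longrightarrow> pres_eq R u w"
| append: "pres_eq R u u' \<Longrightarrow> pres_eq R v v' \<Longrightarrow> pres_eq R (u @ v) (u' @ v')"

definition word_class :: "('g word \<times> 'g word) set \<Rightarrow> 'g word \<Rightarrow> 'g word set" where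
  "word_class R u = {v. pres_eq R u v}"

definition presented_group :: "('g word \<times> 'g word) set \<Rightarrow> 'g word set monoid" where
  "presented_group R =
    \<lparr>carrier = range (word_class R),
     monoid.mult = (\<lambda>A B. \<Union>u\<in>A. \<Union>v\<in>B. word_class R (u @ v)),
     monoid.one = word_class R []\<rparr>"

lemma word_class_eq_iff: "word_class R u = word_class R v \<longleftrightarrow> pres_eq R u v"
  unfolding word_class_def
  by (metis (no_types, lifting) Collect_cong mem_Collect_eq pres_eq.refl pres_eq.sym pres_eq.trans)

lemma mult_word_class:
  "word_class R u \<otimes>\<^bsub>presented_group R\<^esub> word_class R v = word_class R (u @ v)"
proof -
  have "word_class R (u' @ v') = word_class R (u @ v)"
    if "u' \<in> word_class R u" "v' \<in> word_class R v" for u' v'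
    using that unfolding word_class_eq_iff unfolding word_class_def mem_Collect_eq
    by (intro pres_eq.sym[OF pres_eq.append])
  moreover have "u \<in> word_class R u" "v \<in> word_class R v"
    by (auto simp: word_class_def pres_eq.refl)
  ultimately have "(\<Union>u'\<in>word_class R u. \<Union>v'\<in>word_class R v. word_class R (u' @ v'))
      = word_class R (u @ v)"
    by blast
  then show ?thesis
    by (simp add: presented_group_def)
qed

lemma left_inverse_word:
  "pres_eq R (rev (map (\<lambda>(a, b). (a, \<not> b)) u) @ u) []"
proof (induction u)
  case Nil
  show ?case by (simp add: pres_eq.refl)
next
  case (Cons p u)
  obtain a b where p: "p = (a, b)" by force
  let ?i = "rev (map (\<lambda>(a, b). (a, \<not> b)) u)"
  have "pres_eq R [(a, \<not> b), (a, b)] []"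
    using pres_eq.cancel[of R a "\<not> b"] by simp
  from pres_eq.append[OF pres_eq.refl[of R ?i] pres_eq.append[OF this pres_eq.refl[of R u]]]
  have "pres_eq R (?i @ [(a, \<not> b), (a, b)] @ u) (?i @ u)" by simp
  from pres_eq.trans[OF this Cons.IH] show ?case by (simp add: p)
qed

lemma group_presented_group: "group (presented_group R)"
proof (rule groupI)
  let ?G = "presented_group R"
  have car: "carrier ?G = range (word_class R)" and one: "\<one>\<^bsub>?G\<^esub> = word_class R []"
    by (simp_all add: presented_group_def)
  show "\<one>\<^bsub>?G\<^esub> \<in> carrier ?G" by (simp add: car one)
  show "A \<otimes>\<^bsub>?G\<^esub> B \<in> carrier ?G" if "A \<in> carrier ?G" "B \<in> carrier ?G" for A B
    using that by (auto simp: car mult_word_class)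
  show "A \<otimes>\<^bsub>?G\<^esub> B \<otimes>\<^bsub>?G\<^esub> C = A \<otimes>\<^bsub>?G\<^esub> (B \<otimes>\<^bsub>?G\<^esub> C)"
    if "A \<in> carrier ?G" "B \<in> carrier ?G" "C \<in> carrier ?G" for A B C
    using that by (auto simp: car mult_word_class)
  show "\<one>\<^bsub>?G\<^esub> \<otimes>\<^bsub>?G\<^esub> A = A" if "A \<in> carrier ?G" for A
    using that by (auto simp: car one mult_word_class)
  show "\<exists>B\<in>carrier ?G. B \<otimes>\<^bsub>?G\<^esub> A = \<one>\<^bsub>?G\<^esub>" if A: "A \<in> carrier ?G" for A
  proof -
    obtain u where "A = word_class R u" using A by (auto simp: car)
    then have "word_class R (rev (map (\<lambda>(a, b). (a, \<not> b)) u)) \<otimes>\<^bsub>?G\<^esub> A = \<one>\<^bsub>?G\<^esub>"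
      by (simp add: mult_word_class one word_class_eq_iff left_inverse_word)
    then show ?thesis by (auto simp: car)
  qed
qed

datatype quat_gen = gen_x | gen_y

definition quaternion_relations :: "nat \<Rightarrow> (quat_gen word \<times> quat_gen word) set" where
  "quaternion_relations n =
    {(replicate (2 * n) (gen_x, True), []),
     (replicate 2 (gen_y, True), replicate n (gen_x, True)),
     ([(gen_y, False), (gen_x, True), (gen_y, True)], [(gen_x, False)])}"

definition generalized_quaternion :: "nat \<Rightarrow> quat_gen word set monoid" where
  "generalized_quaternion n = presented_group (quaternion_relations n)"

text \<open>Vertex set and set of edges, an edge being a two-element set of vertices.\<close>

type_synonym 'a ugraph = "'a set \<times> 'a set set"

definition ugraph_connected :: "'a ugraph \<Rightarrow> bool" where
  "ugraph_connected H \<longleftrightarrow> fst H \<noteq> {} \<and>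
    (\<forall>u\<in>fst H. \<forall>v\<in>fst H. (u, v) \<in> {(a, b). {a, b} \<in> snd H}\<^sup>*)"

definition ugraph_cycle :: "'a ugraph \<Rightarrow> 'a list \<Rightarrow> bool" where
  "ugraph_cycle H vs \<longleftrightarrow> 3 \<le> length vs \<and> distinct vs \<and>
    (\<forall>i<length vs. {vs ! i, vs ! (Suc i mod length vs)} \<in> snd H)"

definition ugraph_tree :: "'a ugraph \<Rightarrow> bool" where
  "ugraph_tree H \<longleftrightarrow> ugraph_connected H \<and> (\<nexists>vs. ugraph_cycle H vs)"

text \<open>A spanning tree has the same vertex set as the graph, so it is given by its edge set.\<close>

definition spanning_trees :: "'a ugraph \<Rightarrow> 'a set set set" where
  "spanning_trees H = {T. T \<subseteq> snd H \<and> ugraph_tree (fst H, T)}"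

definition power_graph :: "('a, 'b) monoid_scheme \<Rightarrow> 'a ugraph" where
  "power_graph G = (carrier G,
    {{x, y} | x y. x \<in> carrier G \<and> y \<in> carrier G \<and> x \<noteq> y \<and>
      (generate G {x} \<subseteq> generate G {y} \<or> generate G {y} \<subseteq> generate G {x})})"

definition kappa :: "('a, 'b) monoid_scheme \<Rightarrow> nat" where
  "kappa G = card (spanning_trees (power_graph G))"

end

theory Submission
  imports Defs "HOL-Number_Theory.Cong" "HOL-Library.Transitive_Closure_Table"
begin

text \<open>The number of spanning trees is found by counting parent functions. Orienting a spanning tree
towards a fixed root turns it into an acyclic function that sends each vertex other than the root to
a neighbour (lemma \<open>card_spanning_trees\<close>), and such functions can be counted for forests with
several roots.

The counting rests on a symmetry (lemma \<open>card_rooted_forests_insert\<close>). Consider the forests on some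
vertices with a set \<open>R\<close> of roots and one further root \<open>z\<close>, where every vertex is joined to every
root. To make \<open>z\<close> an ordinary vertex, it needs a parent that is not one of its descendants. The roots
are interchangeable, so summed over all forests each of them has equally many descendants, and the
proportion \<open>card R / (card R + 1)\<close> of all pairs of a forest and a candidate for the parent is
admissible. Iterating this gives Cayley's formula \<open>r (a + r)\<^sup>a\<^sup>-\<^sup>1\<close> for the forests on a complete
graph with \<open>r\<close> roots and \<open>a\<close> other vertices (lemma \<open>card_rooted_forests_complete\<close>).

In the generalized quaternion group of order \<open>4 n\<close>, each element \<open>x\<^sup>i y\<close> generates the subgroup
\<open>{1, x\<^sup>n, x\<^sup>i y, x\<^sup>i\<^sup>+\<^sup>n y}\<close>, and if \<open>n\<close> is a power of two then the subgroups of \<open>\<langle>x\<rangle>\<close> form a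
chain. So in the power graph \<open>1\<close> and \<open>x\<^sup>n\<close> are joined to everything, and the other vertices fall
into disjoint cliques: one of size \<open>2 n - 2\<close>, inside \<open>\<langle>x\<rangle>\<close>, and \<open>n\<close> of size \<open>2\<close>. With \<open>1\<close> and
\<open>x\<^sup>n\<close> as roots, Cayley's formula gives \<open>2 (2 n)\<^sup>2\<^sup>n\<^sup>-\<^sup>3\<close> forests on the large clique (to be read as
\<open>1\<close> if \<open>n = 1\<close>) and \<open>8\<close> on each small one. Making \<open>x\<^sup>n\<close> an ordinary vertex multiplies the product
of these numbers by half the number \<open>4 n\<close> of vertices, so
\<open>\<kappa> = 2 n \<cdot> 2 (2 n)\<^sup>2\<^sup>n\<^sup>-\<^sup>3 \<cdot> 8\<^sup>n = 2\<^sup>5\<^sup>n\<^sup>-\<^sup>1 n\<^sup>2\<^sup>n\<^sup>-\<^sup>2\<close>.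

That the presented group has this structure (lemma \<open>quaternion_group_presented\<close>) needs an argument
against collapse: the words act on the expected \<open>4 n\<close> normal forms in accordance with the relations,
and so words with different effects represent different elements.\<close>

section \<open>Rooted forests as acyclic parent functions\<close>

text \<open>A forest is given by its parent function: \<open>A\<close> holds the vertices that have a parent, and the
  roots are the vertices outside \<open>A\<close> at which the arcs end.\<close>

definition arcs :: "'a set \<Rightarrow> ('a \<Rightarrow> 'a) \<Rightarrow> ('a \<times> 'a) set" where
  "arcs A p = (\<lambda>v. (v, p v)) ` A"

text \<open>Parent functions are extensional, so that a forest determines its function and forests can be
  counted. The set \<open>N v\<close> of admissible parents may contain \<open>v\<close> itself, since acyclicity excludes
  \<open>p v = v\<close>; this allows complete graphs to be written with a constant \<open>N\<close>.\<close>

definition rooted_forests :: "'a set \<Rightarrow> ('a \<Rightarrow> 'a set) \<Rightarrow> ('a \<Rightarrow> 'a) set" where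
  "rooted_forests A N = {p \<in> Pi\<^sub>E A N. acyclic (arcs A p)}"

lemma arcs_iff: "(v, w) \<in> arcs A p \<longleftrightarrow> v \<in> A \<and> w = p v"
  by (auto simp: arcs_def)

lemma finite_arcs: "finite A \<Longrightarrow> finite (arcs A p)"
  by (simp add: arcs_def)

lemma arcs_cong: "(\<And>v. v \<in> A \<Longrightarrow> p v = q v) \<Longrightarrow> arcs A p = arcs A q"
  by (auto simp: arcs_def)

lemma finite_rooted_forests:
  assumes "finite A" "\<And>v. v \<in> A \<Longrightarrow> finite (N v)"
  shows "finite (rooted_forests A N)"
  unfolding rooted_forests_def using finite_PiE[OF assms] by simp

lemma rooted_forests_cong:
  assumes "\<And>v. v \<in> A \<Longrightarrow> N v = N' v"
  shows "rooted_forests A N = rooted_forests A N'"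
  unfolding rooted_forests_def using PiE_cong[of A N N'] assms by simp

lemma rooted_forests_empty [simp]: "rooted_forests {} N = {\<lambda>_. undefined}"
  by (auto simp: rooted_forests_def arcs_def acyclic_def)

text \<open>On a finite set, an acyclic chain of parents has to leave \<open>A\<close>, and it can only do so
  through \<open>R\<close>.\<close>

lemma root_exists:
  assumes "finite A" "acyclic (arcs A p)" "\<And>v. v \<in> A \<Longrightarrow> p v \<in> A \<union> R" "v \<in> A \<union> R"
  shows "\<exists>\<rho>\<in>R. (v, \<rho>) \<in> (arcs A p)\<^sup>*"
proof -
  have "wf ((arcs A p)\<inverse>)"
    using assms(1,2) by (simp add: finite_acyclic_wf_converse finite_arcs)
  then show ?thesis using assms(4)
  proof (induction v rule: wf_induct_rule)
    case (less v)
    show ?case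
    proof (cases "v \<in> A")
      case True
      then have a: "(v, p v) \<in> arcs A p" by (simp add: arcs_iff)
      then obtain \<rho> where "\<rho> \<in> R" "(p v, \<rho>) \<in> (arcs A p)\<^sup>*"
        using less.IH[of "p v"] assms(3)[OF True] by auto
      with a show ?thesis by (meson converse_rtrancl_into_rtrancl)
    next
      case False
      with less.prems show ?thesis by auto
    qed
  qed
qed

lemma arcs_rtrancl_from_root: "\<rho> \<notin> A \<Longrightarrow> (\<rho>, w) \<in> (arcs A p)\<^sup>* \<Longrightarrow> w = \<rho>"
  by (erule converse_rtranclE) (auto simp: arcs_iff)

text \<open>Two chains of parents from the same vertex are comparable, and a chain stops at a root.\<close>

lemma root_unique:
  assumes "(v, \<rho>) \<in> (arcs A p)\<^sup>*" "(v, \<rho>') \<in> (arcs A p)\<^sup>*" "\<rho> \<notin> A" "\<rho>' \<notin> A"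
  shows "\<rho> = \<rho>'"
proof -
  have "single_valued (arcs A p)" by (auto simp: single_valued_def arcs_iff)
  from single_valued_confluent[OF this assms(1,2)] show ?thesis
    using arcs_rtrancl_from_root assms(3,4) by metis
qed

lemma map_prod_rtrancl: "(a, b) \<in> r\<^sup>* \<Longrightarrow> (f a, f b) \<in> (map_prod f f ` r)\<^sup>*"
proof (induction rule: rtrancl_induct)
  case base
  show ?case by simp
next
  case (step b c)
  then have "(f b, f c) \<in> map_prod f f ` r" by force
  with step.IH show ?case by (rule rtrancl_into_rtrancl)
qed

lemma map_prod_trancl: "(a, b) \<in> r\<^sup>+ \<Longrightarrow> (f a, f b) \<in> (map_prod f f ` r)\<^sup>+"
proof (induction rule: trancl_induct)
  case (base b)
  then show ?case by force
next
  case (step b c)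
  then have "(f b, f c) \<in> map_prod f f ` r" by force
  with step.IH show ?case by (rule trancl_into_trancl)
qed

section \<open>Counting rooted forests\<close>

text \<open>If every vertex may choose both \<open>\<rho>\<close> and \<open>z\<close> as its parent, then exchanging these two roots is
  an involution on the forests: the arcs of the new forest are the old ones with the names \<open>\<rho>\<close> and
  \<open>z\<close> swapped. Hence \<open>\<rho>\<close> and \<open>z\<close> have, summed over all forests, equally many descendants.\<close>

lemma rename_roots:
  fixes \<rho> z :: 'a and A N
  defines "\<tau> \<equiv> Transposition.transpose \<rho> z"
  assumes "\<rho> \<notin> A" "z \<notin> A" and N: "\<And>v. v \<in> A \<Longrightarrow> \<rho> \<in> N v \<and> z \<in> N v"
    and p: "p \<in> rooted_forests A N" and w: "(w, s) \<in> (arcs A p)\<^sup>*"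
  shows "restrict (\<tau> \<circ> p) A \<in> rooted_forests A N"
    "(\<tau> w, \<tau> s) \<in> (arcs A (restrict (\<tau> \<circ> p) A))\<^sup>*"
    "restrict (\<tau> \<circ> restrict (\<tau> \<circ> p) A) A = p"
proof -
  have fix_A: "\<tau> v = v" if "v \<in> A" for v
    using that assms(2,3) by (auto simp: \<tau>_def transpose_def)
  have invol: "\<tau> (\<tau> v) = v" for v by (simp add: \<tau>_def)
  have arcs: "arcs A (restrict (\<tau> \<circ> p) A) = map_prod \<tau> \<tau> ` arcs A p"
    by (force simp: arcs_def fix_A)
  then have arcs_back: "map_prod \<tau> \<tau> ` arcs A (restrict (\<tau> \<circ> p) A) = arcs A p"
    by (simp add: image_image map_prod_def case_prod_beta invol)
  have "acyclic (arcs A (restrict (\<tau> \<circ> p) A))"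
    using p map_prod_trancl[of _ _ "arcs A (restrict (\<tau> \<circ> p) A)" \<tau>]
    unfolding arcs_back by (auto simp: rooted_forests_def acyclic_def)
  moreover have "\<tau> x \<in> N v" if "x \<in> N v" "v \<in> A" for x v
    using that N by (auto simp: \<tau>_def transpose_def)
  ultimately show "restrict (\<tau> \<circ> p) A \<in> rooted_forests A N"
    using p by (auto simp: rooted_forests_def PiE_iff)
  show "(\<tau> w, \<tau> s) \<in> (arcs A (restrict (\<tau> \<circ> p) A))\<^sup>*"
    using map_prod_rtrancl[OF w, of \<tau>] arcs by simp
  show "restrict (\<tau> \<circ> restrict (\<tau> \<circ> p) A) A = p"
  proof (rule ext)
    fix v
    have "p v = undefined" if "v \<notin> A"
      using p that by (auto simp: rooted_forests_def intro: PiE_arb)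
    then show "restrict (\<tau> \<circ> restrict (\<tau> \<circ> p) A) A v = p v"
      by (simp add: invol)
  qed
qed

text \<open>Turning the root \<open>z\<close> into an ordinary vertex means giving it a parent \<open>w\<close>, which keeps the
  forest acyclic exactly if \<open>w\<close> does not descend from \<open>z\<close>. For one forest the number of such \<open>w\<close>
  depends on its shape, but the total over all forests does not: every vertex descends from exactly
  one of the \<open>card R + 1\<close> roots, and by symmetry each of them gets an equal share of the pairs
  (vertex, forest). So the proportion of the admissible pairs is \<open>card R / (card R + 1)\<close>.\<close>

lemma card_rooted_forests_insert:
  assumes fin: "finite A" "finite R" and disj: "A \<inter> R = {}" "z \<notin> A" "z \<notin> R"
    and N: "\<And>v. v \<in> A \<Longrightarrow> insert z R \<subseteq> N v" "\<And>v. v \<in> A \<Longrightarrow> N v \<subseteq> insert z (A \<union> R)"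
    and Nz: "N z = insert z (A \<union> R)"
  shows "(card R + 1) * card (rooted_forests (insert z A) N)
    = card (rooted_forests A N) * card R * (card A + card R + 1)"
proof -
  define F where "F = rooted_forests A N"
  define V where "V = insert z (A \<union> R)"
  \<comment> \<open>The pairs of a forest and a vertex that descends from the root \<open>\<rho>\<close> in it.\<close>
  define P where "P \<rho> = {(w, p). p \<in> F \<and> w \<in> V \<and> (w, \<rho>) \<in> (arcs A p)\<^sup>*}" for \<rho>
  have finV: "finite V" using fin by (simp add: V_def)
  have cV: "card V = card A + card R + 1" using fin disj by (simp add: V_def card_Un_disjoint)
  have finF: "finite F"
    unfolding F_def using fin N(2) finV by (intro finite_rooted_forests) (auto intro: finite_subset simp: V_def)
  have subP: "P \<rho> \<subseteq> V \<times> F" for \<rho> by (auto simp: P_def)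
  have finP: "finite (P \<rho>)" for \<rho> using subP finV finF by (meson finite_SigmaI finite_subset)
  have swap: "card (P \<rho>) = card (P z)" if \<rho>: "\<rho> \<in> R" for \<rho>
  proof -
    define \<tau> where "\<tau> = Transposition.transpose \<rho> z"
    define g where "g = (\<lambda>(w, p). (\<tau> w, restrict (\<tau> \<circ> p) A))"
    have A: "\<rho> \<notin> A" "z \<notin> A" using \<rho> disj by auto
    have N': "\<rho> \<in> N v \<and> z \<in> N v" if "v \<in> A" for v using N(1)[OF that] \<rho> by auto
    note rr = rename_roots[of \<rho> A z N, OF A N', folded \<tau>_def F_def]
    have V: "\<tau> w \<in> V" if "w \<in> V" for w
      using that \<rho> by (auto simp: \<tau>_def transpose_def V_def)
    have inv: "g (g x) = x" if "x \<in> V \<times> F" for x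
      using that rr(3)[OF _ _ rtrancl_refl] by (auto simp: g_def \<tau>_def)
    have z: "\<tau> \<rho> = z" "\<tau> z = \<rho>" by (auto simp: \<tau>_def)
    have "bij_betw g (P \<rho>) (P z)"
    proof (rule bij_betw_byWitness[where f' = g])
      show "\<forall>x\<in>P \<rho>. g (g x) = x" "\<forall>x\<in>P z. g (g x) = x" using inv subP by blast+
      show "g ` P \<rho> \<subseteq> P z"
        using rr(1,2)[where s = \<rho>] V z by (fastforce simp: P_def g_def)
      show "g ` P z \<subseteq> P \<rho>"
        using rr(1,2)[where s = z] V z by (fastforce simp: P_def g_def)
    qed
    then show ?thesis by (rule bij_betw_same_card)
  qed
  have "(\<Union>\<rho>\<in>insert z R. P \<rho>) = V \<times> F"
  proof
    show "(\<Union>\<rho>\<in>insert z R. P \<rho>) \<subseteq> V \<times> F" using subP by blast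
    show "V \<times> F \<subseteq> (\<Union>\<rho>\<in>insert z R. P \<rho>)"
    proof clarify
      fix w p assume w: "w \<in> V" and p: "p \<in> F"
      have "\<exists>\<rho>\<in>insert z R. (w, \<rho>) \<in> (arcs A p)\<^sup>*"
        using p w N(2) fin(1) by (intro root_exists) (fastforce simp: F_def rooted_forests_def V_def)+
      then show "(w, p) \<in> (\<Union>\<rho>\<in>insert z R. P \<rho>)" using w p by (auto simp: P_def)
    qed
  qed
  moreover have "card (\<Union>\<rho>\<in>insert z R. P \<rho>) = (\<Sum>\<rho>\<in>insert z R. card (P \<rho>))"
    using fin finP disj by (intro card_UN_disjoint) (auto simp: P_def dest: root_unique)
  moreover have "(\<Sum>\<rho>\<in>insert z R. card (P \<rho>)) = (card R + 1) * card (P z)"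
    using swap fin disj by simp
  ultimately have total: "(card R + 1) * card (P z) = card V * card F"
    by (simp add: card_cartesian_product)
  have "rooted_forests (insert z A) N = (\<lambda>(w, p). p(z := w)) ` (V \<times> F - P z)"
  proof -
    have "acyclic (arcs (insert z A) (p(z := w))) \<longleftrightarrow>
        acyclic (arcs A p) \<and> (w, z) \<notin> (arcs A p)\<^sup>*" for p w
    proof -
      have "arcs (insert z A) (p(z := w)) = insert (z, w) (arcs A p)"
        using disj by (auto simp: arcs_def)
      then show ?thesis by (simp add: acyclic_insert)
    qed
    then show ?thesis
      by (force simp: rooted_forests_def PiE_insert_eq P_def F_def V_def Nz)
  qed
  moreover have "inj_on (\<lambda>(w, p). p(z := w)) (V \<times> F - P z)"
    by (rule inj_on_subset[OF inj_combinator[OF disj(2), of N]])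
      (auto simp: F_def V_def Nz rooted_forests_def)
  ultimately have "card (rooted_forests (insert z A) N) = card V * card F - card (P z)"
    by (simp add: card_image card_Diff_subset finP subP card_cartesian_product)
  then have "(card R + 1) * card (rooted_forests (insert z A) N)
      = (card R + 1) * (card V * card F) - card V * card F"
    using total by (simp only: diff_mult_distrib2)
  also have "\<dots> = card F * card R * card V" by (simp add: algebra_simps)
  finally show ?thesis by (simp only: cV F_def)
qed

text \<open>Cayley's formula \<open>r (a + r)\<^sup>a\<^sup>-\<^sup>1\<close> for the forests on a complete graph with \<open>r\<close> prescribed
  roots and \<open>a\<close> other vertices, multiplied by \<open>a + r\<close> so that it also holds without subtraction for
  \<open>a = 0\<close>. Turning the vertices one by one from roots into ordinary vertices keeps \<open>a + r\<close> fixed, and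
  the factors \<open>r / (r + 1)\<close> telescope.\<close>

lemma card_rooted_forests_complete:
  assumes "finite A" "finite R" "A \<inter> R = {}"
  shows "(card A + card R) * card (rooted_forests A (\<lambda>_. A \<union> R)) = card R * (card A + card R) ^ card A"
  using assms
proof (induction A arbitrary: R rule: finite_induct)
  case empty
  show ?case by simp
next
  case (insert z A)
  let ?M = "card A + card R + 1" and ?f = "card (rooted_forests A (\<lambda>_. A \<union> insert z R))"
  have z: "z \<notin> R" "A \<inter> R = {}" using insert by auto
  define c where "c = card (rooted_forests (insert z A) (\<lambda>_. insert z A \<union> R))"
  have step: "(card R + 1) * c = ?f * card R * ?M"
    unfolding c_def using insert z by (subst card_rooted_forests_insert) auto
  have IH: "?M * ?f = (card R + 1) * ?M ^ card A"
    using insert.IH[of "insert z R"] insert.prems insert.hyps z by simp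
  have "(card R + 1) * (?M * c) = ?M * ((card R + 1) * c)" by (simp only: mult_ac)
  also have "\<dots> = ?M * (?f * card R * ?M)" by (simp only: step)
  also have "\<dots> = (?M * ?f) * (card R * ?M)" by (simp only: mult_ac)
  also have "\<dots> = (card R + 1) * (card R * ?M ^ Suc (card A))" by (simp only: IH power_Suc mult_ac)
  finally have "?M * c = card R * ?M ^ Suc (card A)" by (simp only: mult_cancel1) simp
  then show ?case using insert.hyps by (simp add: c_def)
qed

text \<open>If no vertex of \<open>A\<close> may choose its parent in \<open>B\<close>, then a cycle cannot pass through both parts,
  so a forest is an arbitrary pair of a forest on \<open>A\<close> and one on \<open>B\<close>.\<close>

lemma card_rooted_forests_Un:
  assumes fin: "finite A" "finite B" and disj: "A \<inter> B = {}" and N: "\<And>v. v \<in> A \<Longrightarrow> N v \<inter> B = {}"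
  shows "card (rooted_forests (A \<union> B) N) = card (rooted_forests A N) * card (rooted_forests B N)"
proof -
  have acyc: "acyclic (arcs (A \<union> B) p) \<longleftrightarrow> acyclic (arcs A p) \<and> acyclic (arcs B p)"
    if p: "p \<in> Pi A N" for p
  proof -
    have un: "arcs (A \<union> B) p = arcs B p \<union> arcs A p" by (auto simp: arcs_def)
    have "Range (arcs A p) \<inter> Domain (arcs B p) = {}" using p N by (fastforce simp: arcs_def)
    then have "acyclic (arcs B p \<union> arcs A p)" if "acyclic (arcs A p)" "acyclic (arcs B p)"
      using that wf_Un[of "arcs B p" "arcs A p"] fin
      by (simp add: wf_iff_acyclic_if_finite finite_arcs Int_commute)
    moreover have "acyclic (arcs A p) \<and> acyclic (arcs B p)" if "acyclic (arcs B p \<union> arcs A p)"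
      using that by (meson acyclic_subset sup_ge1 sup_ge2)
    ultimately show ?thesis unfolding un by blast
  qed
  define f where "f p = (restrict p A, restrict p B)" for p :: "'a \<Rightarrow> 'a"
  define g where "g = (\<lambda>(p, q) v. if v \<in> A then p v else q v :: 'a)"
  have "bij_betw f (rooted_forests (A \<union> B) N) (rooted_forests A N \<times> rooted_forests B N)"
  proof (rule bij_betw_byWitness[where f' = g])
    show "\<forall>p\<in>rooted_forests (A \<union> B) N. g (f p) = p"
      by (auto simp: f_def g_def rooted_forests_def fun_eq_iff restrict_def PiE_def extensional_def)
    show "\<forall>x\<in>rooted_forests A N \<times> rooted_forests B N. f (g x) = x"
      using disj by (force simp: f_def g_def rooted_forests_def fun_eq_iff restrict_def PiE_def extensional_def)
    show "f ` rooted_forests (A \<union> B) N \<subseteq> rooted_forests A N \<times> rooted_forests B N"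
    proof (rule image_subsetI)
      fix p assume p: "p \<in> rooted_forests (A \<union> B) N"
      have "arcs A (restrict p A) = arcs A p" "arcs B (restrict p B) = arcs B p"
        by (simp_all cong: arcs_cong)
      then show "f p \<in> rooted_forests A N \<times> rooted_forests B N"
        using p acyc[of p] by (auto simp: f_def rooted_forests_def Pi_def)
    qed
    show "g ` (rooted_forests A N \<times> rooted_forests B N) \<subseteq> rooted_forests (A \<union> B) N"
    proof (rule image_subsetI)
      fix x assume "x \<in> rooted_forests A N \<times> rooted_forests B N"
      then obtain p q where x: "x = (p, q)"
        and pq: "p \<in> rooted_forests A N" "q \<in> rooted_forests B N" by auto
      have "arcs A (g (p, q)) = arcs A p" "arcs B (g (p, q)) = arcs B q"
        using disj by (auto intro!: arcs_cong simp: g_def)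
      moreover have "g (p, q) \<in> Pi\<^sub>E (A \<union> B) N"
        using pq disj by (auto simp: g_def rooted_forests_def PiE_def extensional_def)
      ultimately show "g x \<in> rooted_forests (A \<union> B) N"
        using x pq acyc[of "g (p, q)"] by (auto simp: rooted_forests_def PiE_def)
    qed
  qed
  then show ?thesis by (simp add: bij_betw_same_card card_cartesian_product)
qed

lemma card_rooted_forests_UN:
  assumes "finite J" "\<And>j. j \<in> J \<Longrightarrow> finite (C j)"
    and "\<And>i j. i \<in> J \<Longrightarrow> j \<in> J \<Longrightarrow> i \<noteq> j \<Longrightarrow> C i \<inter> C j = {}"
    and "\<And>i j v. i \<in> J \<Longrightarrow> j \<in> J \<Longrightarrow> i \<noteq> j \<Longrightarrow> v \<in> C i \<Longrightarrow> N v \<inter> C j = {}"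
  shows "card (rooted_forests (\<Union>j\<in>J. C j) N) = (\<Prod>j\<in>J. card (rooted_forests (C j) N))"
  using assms
proof (induction J rule: finite_induct)
  case empty
  show ?case by simp
next
  case (insert i J)
  have "card (rooted_forests (C i \<union> (\<Union>j\<in>J. C j)) N)
      = card (rooted_forests (C i) N) * card (rooted_forests (\<Union>j\<in>J. C j) N)"
  proof (rule card_rooted_forests_Un)
    show "finite (C i)" "finite (\<Union>j\<in>J. C j)" using insert by auto
    show "C i \<inter> (\<Union>j\<in>J. C j) = {}" using insert.hyps insert.prems(2)[of i] by fastforce
    show "N v \<inter> (\<Union>j\<in>J. C j) = {}" if "v \<in> C i" for v
      using that insert.hyps insert.prems(3)[of i _ v] by fastforce
  qed
  moreover have "card (rooted_forests (\<Union>j\<in>J. C j) N) = (\<Prod>j\<in>J. card (rooted_forests (C j) N))"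
  proof (rule insert.IH)
    show "N v \<inter> C k = {}" if "j \<in> J" "k \<in> J" "j \<noteq> k" "v \<in> C j" for j k v
      using insert.prems(3)[of j k v] that by simp
  qed (use insert.prems in simp_all)
  ultimately show ?case using insert.hyps by simp
qed

section \<open>Spanning trees as rooted forests\<close>

definition tree_edges :: "'a set \<Rightarrow> ('a \<Rightarrow> 'a) \<Rightarrow> 'a set set" where
  "tree_edges A p = (\<lambda>v. {v, p v}) ` A"

lemma tree_edges_iff: "{a, b} \<in> tree_edges A p \<longleftrightarrow> (a, b) \<in> arcs A p \<or> (b, a) \<in> arcs A p"
  by (auto simp: tree_edges_def arcs_def doubleton_eq_iff)

text \<open>Some vertex of a cycle is not the parent of any vertex of the cycle. Both its neighbours on
  the cycle must then be its parent, although they are distinct.\<close>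

lemma acyclic_arcs_no_cycle:
  assumes "finite A" "acyclic (arcs A p)"
  shows "\<not> ugraph_cycle (V, tree_edges A p) vs"
proof
  assume cyc: "ugraph_cycle (V, tree_edges A p) vs"
  define l where "l = length vs"
  have l: "3 \<le> l" and dist: "distinct vs"
    and edge: "\<And>i. i < l \<Longrightarrow> {vs ! i, vs ! (Suc i mod l)} \<in> tree_edges A p"
    using cyc by (auto simp: ugraph_cycle_def l_def)
  have "wf (arcs A p)"
    using assms by (simp add: wf_iff_acyclic_if_finite finite_arcs)
  moreover have "vs ! 0 \<in> set vs" using l unfolding l_def by (intro nth_mem) linarith
  ultimately obtain v where v: "v \<in> set vs" and no_child: "\<And>u. (u, v) \<in> arcs A p \<Longrightarrow> u \<notin> set vs"
    by (rule wfE_min) blast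
  obtain i where i: "i < l" "v = vs ! i" using v by (auto simp: in_set_conv_nth l_def)
  \<comment> \<open>The indices of the two neighbours of \<open>v\<close>, in front of it and behind it, around the cycle.\<close>
  define j where "j = (if i = 0 then l - 1 else i - 1)"
  define k where "k = (if i = l - 1 then 0 else i + 1)"
  have j: "j < l" "Suc j mod l = i" and k: "k < l" "Suc i mod l = k" and "j \<noteq> k"
    using i l by (auto simp: j_def k_def)
  have "(vs ! i, vs ! k) \<in> arcs A p"
    using edge[OF i(1)] k no_child[of "vs ! k"] i(2) by (auto simp: tree_edges_iff l_def)
  moreover have "(vs ! i, vs ! j) \<in> arcs A p"
    using edge[OF j(1)] j no_child[of "vs ! j"] i(2) by (auto simp: tree_edges_iff l_def)
  ultimately have "vs ! j = vs ! k" by (simp add: arcs_iff)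
  then show False using dist j(1) k(1) \<open>j \<noteq> k\<close> by (simp add: nth_eq_iff_index_eq l_def)
qed

lemma rooted_forest_connected:
  assumes V: "finite V" "r \<in> V" and p: "acyclic (arcs (V - {r}) p)" "\<And>v. v \<in> V - {r} \<Longrightarrow> p v \<in> V"
  shows "ugraph_connected (V, tree_edges (V - {r}) p)"
proof -
  define Q where "Q = {(a, b). {a, b} \<in> tree_edges (V - {r}) p}"
  have sub: "arcs (V - {r}) p \<subseteq> Q" by (auto simp: Q_def tree_edges_iff)
  have to_r: "(v, r) \<in> Q\<^sup>*" if "v \<in> V" for v
    using root_exists[of "V - {r}" p "{r}" v] V p that rtrancl_mono[OF sub] by auto
  have "sym (Q\<^sup>*)" by (intro sym_rtrancl) (auto simp: sym_def Q_def insert_commute)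
  then have "(u, v) \<in> Q\<^sup>*" if "u \<in> V" "v \<in> V" for u v
    using to_r[OF that(1)] to_r[OF that(2)] by (meson rtrancl_trans symD)
  then show ?thesis using V by (auto simp: ugraph_connected_def Q_def)
qed

text \<open>The edges determine the orientation: if \<open>q\<close> oriented the edge from \<open>v\<close> to \<open>p v\<close> the other
  way, then \<open>q (p v) = v\<close>. By induction from the roots \<open>q (p v) = p (p v)\<close>, so \<open>v\<close> and \<open>p v\<close>
  would be parents of each other.\<close>

lemma tree_edges_inj:
  assumes fin: "finite A" and p: "p \<in> rooted_forests A N" and q: "q \<in> rooted_forests A N"
    and eq: "tree_edges A p = tree_edges A q"
  shows "p = q"
proof -
  have ac: "acyclic (arcs A p)" using p by (simp add: rooted_forests_def)
  then have "wf ((arcs A p)\<inverse>)"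
    using fin by (simp add: finite_acyclic_wf_converse finite_arcs)
  then have "p v = q v" if "v \<in> A" for v using that
  proof (induction v rule: wf_induct_rule)
    case (less v)
    have "(v, p v) \<in> arcs A p" using less.prems by (simp add: arcs_iff)
    moreover from this have "{v, p v} \<in> tree_edges A q" by (simp add: tree_edges_iff flip: eq)
    moreover have False if back_arc: "(p v, v) \<in> arcs A q"
    proof -
      have "p (p v) = q (p v)"
        using less.IH[of "p v"] less.prems back_arc by (simp add: arcs_iff)
      then have "(p v, v) \<in> arcs A p" using back_arc by (simp add: arcs_iff)
      then have "(v, v) \<in> (arcs A p)\<^sup>+"
        using \<open>(v, p v) \<in> arcs A p\<close> by (meson r_into_trancl trancl_into_trancl)
      then show False using ac by (simp add: acyclic_def)
    qed
    ultimately show ?case by (auto simp: tree_edges_iff arcs_iff)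
  qed
  then show ?thesis using p q by (auto simp: rooted_forests_def intro: PiE_ext)
qed

text \<open>A further edge of \<open>T\<close> would close a cycle with a simple path in \<open>S\<close> between its end points.\<close>

lemma tree_eq_of_connected_subgraph:
  assumes T: "ugraph_tree (V, T)" and S: "ugraph_connected (V, S)" "S \<subseteq> T"
    and edges: "\<And>e. e \<in> T \<Longrightarrow> \<exists>a b. e = {a, b} \<and> a \<noteq> b \<and> a \<in> V \<and> b \<in> V"
  shows "S = T"
proof (rule ccontr)
  assume "S \<noteq> T"
  then obtain e where "e \<in> T" "e \<notin> S" using S(2) by blast
  then obtain a b where ab: "{a, b} \<in> T" "{a, b} \<notin> S" "a \<noteq> b" "a \<in> V" "b \<in> V"
    using edges by metis
  have "(a, b) \<in> {(a, b). {a, b} \<in> S}\<^sup>*" using S(1) ab by (simp add: ugraph_connected_def)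
  then have "(\<lambda>a b. {a, b} \<in> S)\<^sup>*\<^sup>* a b" by (simp add: rtranclp_rtrancl_eq)
  then obtain xs0 where "rtrancl_path (\<lambda>a b. {a, b} \<in> S) a xs0 b"
    using rtranclp_eq_rtrancl_path by metis
  then obtain xs where path: "rtrancl_path (\<lambda>a b. {a, b} \<in> S) a xs b" and dist: "distinct (a # xs)"
    by (rule rtrancl_path_distinct)
  have ne: "xs \<noteq> []" using path \<open>a \<noteq> b\<close> by (auto elim: rtrancl_path.cases)
  then have last: "last xs = b" using rtrancl_path_last[OF path] by simp
  have step: "{(a # xs) ! i, xs ! i} \<in> S" if "i < length xs" for i
    using rtrancl_path_nth[OF path that] .
  have "length xs \<noteq> 1"
  proof
    assume "length xs = 1"
    then have "xs = [b]" using last by (cases xs) auto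
    then show False using step[of 0] ab by simp
  qed
  then have len: "2 \<le> length xs" using ne by (cases xs) (auto simp: Suc_le_eq)
  have "{(a # xs) ! i, (a # xs) ! (Suc i mod length (a # xs))} \<in> T" if "i < length (a # xs)" for i
  proof (cases "i < length xs")
    case True
    then show ?thesis using step[of i] S(2) by auto
  next
    case False
    then have "i = length xs" using that by simp
    then show ?thesis using ab(1) last ne by (simp add: last_conv_nth insert_commute nth_Cons')
  qed
  then have "ugraph_cycle (V, T) (a # xs)"
    using dist len by (simp add: ugraph_cycle_def)
  then show False using T by (auto simp: ugraph_tree_def)
qed

text \<open>The parent of a vertex is a neighbour that is closer to \<open>r\<close>.\<close>

lemma parent_function_of_connected:
  assumes T: "ugraph_connected (V, T)" and r: "r \<in> V"
    and edges: "\<And>a b. {a, b} \<in> T \<Longrightarrow> b \<in> V"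
  obtains p where "p \<in> rooted_forests (V - {r}) (\<lambda>v. {w \<in> V. {v, w} \<in> T})"
proof -
  define Q where "Q = {(a, b). {a, b} \<in> T}"
  define d where "d v = (LEAST k. (v, r) \<in> Q ^^ k)" for v
  have "\<exists>w\<in>V. {v, w} \<in> T \<and> d w < d v" if v: "v \<in> V - {r}" for v
  proof -
    have "(v, r) \<in> Q\<^sup>*" using T v r by (auto simp: ugraph_connected_def Q_def)
    then have dv: "(v, r) \<in> Q ^^ d v"
      unfolding d_def by (metis LeastI rtrancl_imp_relpow)
    moreover have "d v \<noteq> 0" using dv v by (auto intro!: Nat.gr0I)
    ultimately obtain k where k: "d v = Suc k" "(v, r) \<in> Q ^^ Suc k" by (metis not0_implies_Suc)
    from relpow_Suc_D2[OF k(2)] obtain w where w: "(v, w) \<in> Q" "(w, r) \<in> Q ^^ k" by blast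
    then have "d w \<le> k" unfolding d_def by (intro Least_le)
    then show ?thesis using w(1) k(1) edges by (auto simp: Q_def)
  qed
  then obtain p where p: "\<And>v. v \<in> V - {r} \<Longrightarrow> p v \<in> V \<and> {v, p v} \<in> T \<and> d (p v) < d v"
    by metis
  have "arcs (V - {r}) (restrict p (V - {r})) \<subseteq> (measure d)\<inverse>"
    using p by (simp add: arcs_def image_subset_iff)
  then have "acyclic (arcs (V - {r}) (restrict p (V - {r})))"
    by (rule acyclic_subset[rotated]) (simp add: wf_acyclic)
  then show thesis
    using p by (intro that[of "restrict p (V - {r})"]) (simp add: rooted_forests_def)
qed

text \<open>A spanning tree becomes a parent function when its edges are oriented towards the root \<open>r\<close>.\<close>

lemma card_spanning_trees:
  assumes V: "finite V" "r \<in> V"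
    and edges: "\<And>e. e \<in> E \<Longrightarrow> \<exists>a b. e = {a, b} \<and> a \<noteq> b \<and> a \<in> V \<and> b \<in> V"
  shows "card (spanning_trees (V, E))
    = card (rooted_forests (V - {r}) (\<lambda>v. {w \<in> V. w = v \<or> {v, w} \<in> E}))"
proof -
  define A where "A = V - {r}"
  let ?F = "rooted_forests A (\<lambda>v. {w \<in> V. w = v \<or> {v, w} \<in> E})"
  have finA: "finite A" using V by (simp add: A_def)
  have "tree_edges A p \<in> spanning_trees (V, E)" if p: "p \<in> ?F" for p
  proof -
    have ac: "acyclic (arcs A p)" and nb: "\<And>v. v \<in> A \<Longrightarrow> p v \<in> V \<and> (p v = v \<or> {v, p v} \<in> E)"
      using p by (auto simp: rooted_forests_def)
    have "p v \<noteq> v" if "v \<in> A" for v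
    proof
      assume "p v = v"
      then have "(v, v) \<in> arcs A p" using that by (simp add: arcs_iff)
      then show False using ac by (auto simp: acyclic_def)
    qed
    then have "tree_edges A p \<subseteq> E" using nb by (auto simp: tree_edges_def)
    moreover have "ugraph_connected (V, tree_edges A p)"
      using rooted_forest_connected[OF V, of p] ac nb by (simp add: A_def)
    ultimately show ?thesis
      using acyclic_arcs_no_cycle[OF finA ac] by (simp add: spanning_trees_def ugraph_tree_def)
  qed
  moreover have "T \<in> tree_edges A ` ?F" if T: "T \<in> spanning_trees (V, E)" for T
  proof -
    have TE: "T \<subseteq> E" and tree: "ugraph_tree (V, T)" using T by (auto simp: spanning_trees_def)
    have inV: "b \<in> V" if "{a, b} \<in> T" for a b
    proof -
      from that TE have "{a, b} \<in> E" by blast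
      from edges[OF this] show ?thesis by (auto simp: doubleton_eq_iff)
    qed
    obtain p where p: "p \<in> rooted_forests A (\<lambda>v. {w \<in> V. {v, w} \<in> T})"
      using parent_function_of_connected[of V T r] tree V(2) inV
      unfolding A_def ugraph_tree_def by blast
    have "p \<in> ?F" using p TE unfolding rooted_forests_def by (auto simp: PiE_iff)
    moreover have "tree_edges A p = T"
    proof (rule tree_eq_of_connected_subgraph[OF tree])
      show "ugraph_connected (V, tree_edges A p)"
        unfolding A_def using V p by (intro rooted_forest_connected) (auto simp: rooted_forests_def A_def)
      show "tree_edges A p \<subseteq> T" using p by (auto simp: rooted_forests_def tree_edges_def)
    qed (use TE edges in blast)
    ultimately show ?thesis by blast
  qed
  moreover have "inj_on (tree_edges A) ?F"
    using tree_edges_inj[OF finA] by (auto simp: inj_on_def)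
  ultimately have "bij_betw (tree_edges A) ?F (spanning_trees (V, E))"
    unfolding bij_betw_def by blast
  then show ?thesis by (simp add: A_def bij_betw_same_card)
qed

section \<open>Power graphs\<close>

lemma (in group) generate_singleton_subset_iff:
  assumes "x \<in> carrier G" "y \<in> carrier G"
  shows "generate G {x} \<subseteq> generate G {y} \<longleftrightarrow> x \<in> generate G {y}"
proof
  assume "generate G {x} \<subseteq> generate G {y}"
  then show "x \<in> generate G {y}" using generate.incl[of x "{x}" G] by blast
next
  assume "x \<in> generate G {y}"
  then show "generate G {x} \<subseteq> generate G {y}"
    using assms(2) by (intro generate_subgroup_incl generate_is_subgroup) auto
qed

text \<open>A cyclic subgroup is contained in another one if its generator is, so for \<open>v\<close> in the group
  these are the vertices that are equal or adjacent to \<open>v\<close> in the power graph.\<close>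

definition closed_neighbours :: "('a, 'b) monoid_scheme \<Rightarrow> 'a \<Rightarrow> 'a set" where
  "closed_neighbours G v = {w \<in> carrier G. v \<in> generate G {w} \<or> w \<in> generate G {v}}"

lemma (in group) kappa_eq_card_rooted_forests:
  assumes "finite (carrier G)" "r \<in> carrier G"
  shows "kappa G = card (rooted_forests (carrier G - {r}) (closed_neighbours G))"
proof -
  define E where "E = snd (power_graph G)"
  have E_eq: "E = {{x, y} | x y. x \<in> carrier G \<and> y \<in> carrier G \<and> x \<noteq> y \<and>
      (x \<in> generate G {y} \<or> y \<in> generate G {x})}"
    unfolding E_def power_graph_def snd_conv
    by (intro Collect_cong ex_cong1 conj_cong refl) (simp_all add: generate_singleton_subset_iff)
  have E: "{v, w} \<in> E \<longleftrightarrow> v \<in> carrier G \<and> w \<in> carrier G \<and> v \<noteq> w \<and>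
      (v \<in> generate G {w} \<or> w \<in> generate G {v})" for v w
    unfolding E_eq mem_Collect_eq doubleton_eq_iff by metis
  have "kappa G = card (spanning_trees (carrier G, E))" by (simp add: kappa_def power_graph_def E_def)
  also have "\<dots> = card (rooted_forests (carrier G - {r}) (\<lambda>v. {w \<in> carrier G. w = v \<or> {v, w} \<in> E}))"
    using assms by (intro card_spanning_trees) (auto simp: E_eq)
  also have "\<dots> = card (rooted_forests (carrier G - {r}) (closed_neighbours G))"
    by (intro arg_cong[of _ _ card] rooted_forests_cong)
      (auto simp: closed_neighbours_def E generate.incl)
  finally show ?thesis .
qed

text \<open>Conjugation by \<open>y\<close> is a homomorphism, so it inverts all powers of \<open>x\<close> if it inverts \<open>x\<close>.\<close>

lemma (in group) int_pow_commute_inverting: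
  fixes i :: int
  assumes [simp]: "x \<in> carrier G" "y \<in> carrier G" and conj: "x \<otimes> y = y \<otimes> inv x"
  shows "x [^] i \<otimes> y = y \<otimes> x [^] (- i)"
proof -
  have conj': "inv y \<otimes> x \<otimes> y = inv x"
    by (simp add: m_assoc conj) (simp flip: m_assoc)
  have hom: "(\<lambda>g. inv y \<otimes> g \<otimes> y) \<in> hom G G"
  proof (rule homI)
    fix g h assume [simp]: "g \<in> carrier G" "h \<in> carrier G"
    have "inv y \<otimes> g \<otimes> y \<otimes> (inv y \<otimes> h \<otimes> y) = inv y \<otimes> g \<otimes> (y \<otimes> inv y) \<otimes> h \<otimes> y"
      by (simp only: m_assoc m_closed inv_closed assms \<open>g \<in> carrier G\<close> \<open>h \<in> carrier G\<close>)
    also have "\<dots> = inv y \<otimes> (g \<otimes> h) \<otimes> y" by (simp add: m_assoc)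
    finally show "inv y \<otimes> (g \<otimes> h) \<otimes> y = inv y \<otimes> g \<otimes> y \<otimes> (inv y \<otimes> h \<otimes> y)" by simp
  qed simp
  have "inv y \<otimes> x [^] i \<otimes> y = inv x [^] i"
    using hom_int_pow[OF hom _ is_group is_group, of x i] by (simp add: conj')
  then have eq: "inv y \<otimes> x [^] i \<otimes> y = x [^] (- i)" by (simp add: int_pow_inv int_pow_neg)
  have "x [^] i \<otimes> y = (y \<otimes> inv y) \<otimes> (x [^] i \<otimes> y)" by simp
  also have "\<dots> = y \<otimes> (inv y \<otimes> x [^] i \<otimes> y)"
    by (simp only: m_assoc m_closed inv_closed int_pow_closed assms)
  finally show ?thesis by (simp only: eq)
qed

text \<open>The subgroups of a cyclic group of prime power order form a chain: \<open>i\<close> generates the same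
  subgroup as its greatest common divisor with the modulus, which is a power of the prime.\<close>

lemma cong_multiple_or_multiple_power_of_prime:
  fixes i j p :: int
  assumes "normalization_semidom_class.prime p"
  shows "(\<exists>t. [i * t = j] (mod p ^ m)) \<or> (\<exists>t. [j * t = i] (mod p ^ m))"
proof -
  have "\<exists>a. gcd k (p ^ m) = p ^ a" for k
    using divides_primepow[OF assms, of "gcd k (p ^ m)" m] by auto
  then obtain a b where ab: "gcd i (p ^ m) = p ^ a" "gcd j (p ^ m) = p ^ b" by metis
  have "gcd i (p ^ m) dvd j \<or> gcd j (p ^ m) dvd i"
  proof (cases "a \<le> b")
    case True
    then have "p ^ a dvd p ^ b" by (rule le_imp_power_dvd)
    then show ?thesis using ab by (metis dvd_trans gcd_dvd1)
  next
    case False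
    then have "p ^ b dvd p ^ a" by (intro le_imp_power_dvd) simp
    then show ?thesis using ab by (metis dvd_trans gcd_dvd1)
  qed
  then show ?thesis using cong_solve_dvd_int by blast
qed

section \<open>The power graph of a generalized quaternion group\<close>

text \<open>The multiplicative structure of the group of order \<open>4 n\<close>: each element is \<open>x\<^sup>i\<close> or \<open>x\<^sup>i y\<close>, and
  these are distinct for \<open>0 \<le> i < 2 n\<close>.\<close>

locale quaternion_group = group G for G (structure) +
  fixes x y :: 'a and n :: nat
  assumes n_pos: "0 < n"
    and x_closed [simp]: "x \<in> carrier G" and y_closed [simp]: "y \<in> carrier G"
    and ord_x: "ord x = 2 * n"
    and y_square: "y \<otimes> y = x [^] int n"
    and y_conj: "x \<otimes> y = y \<otimes> inv x"
    and y_not_power: "y \<noteq> x [^] (i :: int)"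
    and carrier_eq: "carrier G = range (\<lambda>i :: int. x [^] i) \<union> range (\<lambda>i :: int. x [^] i \<otimes> y)"
begin

lemma pow_eq_iff: "x [^] i = x [^] j \<longleftrightarrow> [i = j] (mod (2 * int n))" for i j :: int
  by (simp add: int_pow_eq ord_x cong_iff_dvd_diff dvd_diff_commute)

lemma pow_y_eq_iff: "x [^] i \<otimes> y = x [^] j \<otimes> y \<longleftrightarrow> [i = j] (mod (2 * int n))" for i j :: int
  by (simp add: right_cancel flip: pow_eq_iff)

lemma pow_y_neq_pow: "x [^] i \<otimes> y \<noteq> x [^] j" for i j :: int
proof
  assume "x [^] i \<otimes> y = x [^] j"
  then have "y = x [^] (- i) \<otimes> x [^] j"
    by (metis x_closed y_closed int_pow_closed int_pow_neg inv_solve_left)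
  then show False using y_not_power by (metis int_pow_mult x_closed)
qed

lemma pow_commute_y: "x [^] i \<otimes> y = y \<otimes> x [^] (- i)" for i :: int
  by (rule int_pow_commute_inverting) (simp_all add: y_conj)

lemma generate_pow_x: "generate G {x [^] i} = range (\<lambda>t :: int. x [^] (i * t))" for i :: int
  by (auto simp: generate_pow int_pow_pow)

lemma pow_n_times: "x [^] (int n * t) = (if even t then \<one> else x [^] int n)"
proof -
  have "[int n * t = (if even t then 0 else int n)] (mod (2 * int n))"
    by (auto elim!: evenE oddE simp: cong_iff_dvd_diff algebra_simps)
  then have "x [^] (int n * t) = x [^] (if even t then 0 else int n)" by (simp only: pow_eq_iff)
  then show ?thesis by simp
qed

text \<open>The elements outside \<open>\<langle>x\<rangle>\<close> have order four, because their square is the involution \<open>x\<^sup>n\<close>.\<close>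

lemma generate_pow_x_y:
  fixes i :: int
  shows "generate G {x [^] i \<otimes> y} = {\<one>, x [^] int n, x [^] i \<otimes> y, x [^] (i + int n) \<otimes> y}"
proof -
  let ?g = "x [^] i \<otimes> y" and ?Z = "x [^] int n"
  have sq: "?g \<otimes> ?g = ?Z"
  proof -
    have "?g \<otimes> ?g = y \<otimes> x [^] (- i) \<otimes> (x [^] i \<otimes> y)" by (metis pow_commute_y)
    also have "\<dots> = y \<otimes> (x [^] (- i) \<otimes> x [^] i) \<otimes> y" by (simp add: m_assoc)
    also have "\<dots> = ?Z" by (simp add: y_square flip: int_pow_mult)
    finally show ?thesis .
  qed
  have even: "?g [^] (2 * t) = x [^] (int n * t)" for t :: int
  proof -
    have "?g [^] (2 * t) = (?g [^] (2 :: int)) [^] t" by (simp add: int_pow_pow)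
    also have "?g [^] (2 :: int) = ?g \<otimes> ?g" using int_pow_mult[of ?g 1 1] by simp
    finally show ?thesis by (simp add: sq int_pow_pow)
  qed
  have odd: "?g [^] (2 * t + 1) = x [^] (int n * t) \<otimes> ?g" for t :: int
    by (simp add: int_pow_mult even)
  have Zy: "?Z \<otimes> ?g = x [^] (i + int n) \<otimes> y"
    by (subst add.commute) (simp add: int_pow_mult m_assoc)
  have "?g [^] k \<in> {\<one>, ?Z, ?g, x [^] (i + int n) \<otimes> y}" for k :: int
  proof (cases "even k")
    case True
    then show ?thesis by (auto elim!: evenE simp: even pow_n_times)
  next
    case False
    then obtain t where "k = 2 * t + 1" by (rule oddE)
    then show ?thesis by (auto simp: odd pow_n_times Zy)
  qed
  moreover have "\<one> = ?g [^] (0 :: int)" by simp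
  moreover have "?Z = ?g [^] (2 :: int)" using even[of 1] by simp
  moreover have "?g = ?g [^] (1 :: int)" by simp
  moreover have "x [^] (i + int n) \<otimes> y = ?g [^] (3 :: int)"
    using odd[of 1] by (simp add: Zy)
  ultimately show ?thesis unfolding generate_pow[OF m_closed[OF int_pow_closed[OF x_closed] y_closed]]
    by blast
qed

text \<open>Both elements lie in every subgroup \<open>\<langle>x\<^sup>i y\<rangle>\<close>, hence are joined to all \<open>x\<^sup>i y\<close>. If \<open>n\<close> is
  a power of two, then they are joined to the whole group, and removing them from the power graph
  leaves the disjoint cliques given by the blocks below.\<close>

definition axis :: "'a set" where "axis = {\<one>, x [^] int n}"

definition cyclic_block :: "'a set" where
  "cyclic_block = range (\<lambda>i :: int. x [^] i) - axis"

definition quaternion_block :: "int \<Rightarrow> 'a set" where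
  "quaternion_block i = {x [^] i \<otimes> y, x [^] (i + int n) \<otimes> y}"

lemma pow_y_in_block_iff:
  "x [^] j \<otimes> y \<in> quaternion_block i \<longleftrightarrow> [i = j] (mod int n)" for i j :: int
proof -
  have "[j = i] (mod (2 * int n)) \<or> [j = i + int n] (mod (2 * int n)) \<longleftrightarrow> [i = j] (mod int n)"
  proof
    assume "[i = j] (mod int n)"
    then obtain t where t: "j = i + int n * t" by (auto simp: cong_iff_lin)
    show "[j = i] (mod (2 * int n)) \<or> [j = i + int n] (mod (2 * int n))"
      by (cases "even t") (auto elim!: evenE oddE simp: t cong_iff_dvd_diff algebra_simps)
  qed (auto simp: cong_iff_dvd_diff algebra_simps elim!: dvdE intro: dvd_diff_commute[THEN iffD1])
  then show ?thesis by (simp add: quaternion_block_def pow_y_eq_iff)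
qed

lemma axis_powers: "axis \<subseteq> range (\<lambda>i :: int. x [^] i)"
  using rangeI[of "\<lambda>i :: int. x [^] i" 0] by (auto simp: axis_def)

lemma card_axis: "finite axis" "card axis = 2"
proof -
  have "x [^] int n \<noteq> x [^] (0 :: int)"
    using n_pos by (simp add: pow_eq_iff cong_iff_dvd_diff zdvd_not_zless del: int_pow_0)
  then show "finite axis" "card axis = 2" by (auto simp: axis_def)
qed

lemma card_cyclic_block: "finite cyclic_block" "card cyclic_block = 2 * n - 2"
proof -
  have "range (\<lambda>i :: int. x [^] i) = (\<lambda>i. x [^] i) ` {0..<2 * int n}"
  proof
    show "range (\<lambda>i :: int. x [^] i) \<subseteq> (\<lambda>i. x [^] i) ` {0..<2 * int n}"
    proof clarify
      fix i :: int
      have "x [^] i = x [^] (i mod (2 * int n))" by (simp add: pow_eq_iff cong_def)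
      then show "x [^] i \<in> (\<lambda>i. x [^] i) ` {0..<2 * int n}" using n_pos by auto
    qed
  qed auto
  moreover have "inj_on (\<lambda>i. x [^] i) {0..<2 * int n}"
    by (auto simp: inj_on_def pow_eq_iff cong_def)
  ultimately have "finite (range (\<lambda>i :: int. x [^] i))" "card (range (\<lambda>i :: int. x [^] i)) = 2 * n"
    by (simp_all add: card_image)
  then show "finite cyclic_block" "card cyclic_block = 2 * n - 2"
    using card_axis axis_powers by (simp_all add: cyclic_block_def card_Diff_subset)
qed

lemma card_quaternion_block: "finite (quaternion_block i)" "card (quaternion_block i) = 2"
proof -
  have "x [^] i \<otimes> y \<noteq> x [^] (i + int n) \<otimes> y"
    using n_pos by (simp add: pow_y_eq_iff cong_iff_dvd_diff zdvd_not_zless)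
  then show "finite (quaternion_block i)" "card (quaternion_block i) = 2"
    by (auto simp: quaternion_block_def)
qed

lemma quaternion_block_disjoint_powers: "x [^] j \<notin> quaternion_block i" for j :: int
  using pow_y_neq_pow by (metis insertE quaternion_block_def singletonD)

lemma quaternion_blocks_disjoint:
  assumes "i \<in> {0..<int n}" "j \<in> {0..<int n}" "i \<noteq> j"
  shows "quaternion_block i \<inter> quaternion_block j = {}"
proof -
  have "\<not> [i = j] (mod int n)" using assms by (auto simp: cong_def)
  then have "x [^] i \<otimes> y \<notin> quaternion_block j" "x [^] (i + int n) \<otimes> y \<notin> quaternion_block j"
    by (auto simp: pow_y_in_block_iff cong_def)
  then show ?thesis by (auto simp: quaternion_block_def)
qed

lemma carrier_decomp:
  "carrier G = axis \<union> cyclic_block \<union> (\<Union>i\<in>{0..<int n}. quaternion_block i)"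
proof -
  have "x [^] j \<otimes> y \<in> (\<Union>i\<in>{0..<int n}. quaternion_block i)" for j :: int
  proof -
    have "x [^] j \<otimes> y \<in> quaternion_block (j mod int n)" by (simp add: pow_y_in_block_iff cong_def)
    then show ?thesis using n_pos by auto
  qed
  then have "(\<Union>i\<in>{0..<int n}. quaternion_block i) = range (\<lambda>i :: int. x [^] i \<otimes> y)"
    by (auto simp: quaternion_block_def)
  then show ?thesis using axis_powers by (auto simp: carrier_eq cyclic_block_def)
qed

lemma pow_neighbour_pow_y:
  "x [^] j \<in> closed_neighbours G (x [^] i \<otimes> y) \<longleftrightarrow> x [^] j \<in> axis" for i j :: int
  using pow_y_neq_pow by (auto simp: closed_neighbours_def generate_pow_x generate_pow_x_y axis_def)
    (metis pow_y_neq_pow)+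

lemma closed_neighbours_sym:
  "v \<in> carrier G \<Longrightarrow> w \<in> carrier G \<Longrightarrow> v \<in> closed_neighbours G w \<longleftrightarrow> w \<in> closed_neighbours G v"
  by (auto simp: closed_neighbours_def)

lemma closed_neighbours_pow_y:
  "closed_neighbours G (x [^] i \<otimes> y) = axis \<union> quaternion_block i" for i :: int
proof -
  have "x [^] j \<otimes> y \<in> closed_neighbours G (x [^] i \<otimes> y) \<longleftrightarrow> x [^] j \<otimes> y \<in> quaternion_block i" for j :: int
  proof -
    have gen: "x [^] j \<otimes> y \<in> generate G {x [^] i \<otimes> y} \<longleftrightarrow> [i = j] (mod int n)" for i j :: int
      using pow_y_neq_pow[of j 0] pow_y_neq_pow[of j "int n"] pow_y_in_block_iff[of j i]
      by (auto simp: generate_pow_x_y quaternion_block_def)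
    show ?thesis by (auto simp: closed_neighbours_def gen pow_y_in_block_iff cong_sym_eq)
  qed
  moreover have "x [^] j \<in> closed_neighbours G (x [^] i \<otimes> y) \<longleftrightarrow> x [^] j \<in> axis \<union> quaternion_block i" for j :: int
    by (simp add: pow_neighbour_pow_y quaternion_block_disjoint_powers)
  moreover have "x [^] j \<otimes> y \<notin> axis" for j :: int
    using pow_y_neq_pow axis_powers by blast
  moreover have "closed_neighbours G (x [^] i \<otimes> y) \<subseteq> carrier G" by (auto simp: closed_neighbours_def)
  moreover have "axis \<union> quaternion_block i \<subseteq> carrier G"
    by (auto simp: axis_def quaternion_block_def)
  ultimately show ?thesis unfolding carrier_eq by blast
qed

text \<open>Here the power of two matters: the order of \<open>\<langle>x\<rangle>\<close> is a power of two as well, so of any two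
  of its cyclic subgroups one contains the other.\<close>

lemma pow_neighbour_pow:
  fixes i j :: int
  assumes "n = 2 ^ k"
  shows "x [^] j \<in> closed_neighbours G (x [^] i)"
  using cong_multiple_or_multiple_power_of_prime[of 2 i j "Suc k"] assms
  by (auto simp: closed_neighbours_def generate_pow_x pow_eq_iff image_iff cong_sym_eq)

lemma closed_neighbours_pow:
  fixes i :: int
  assumes "n = 2 ^ k" "x [^] i \<notin> axis"
  shows "closed_neighbours G (x [^] i) = axis \<union> cyclic_block"
proof -
  have no_y: "x [^] j \<otimes> y \<notin> closed_neighbours G (x [^] i)" for j :: int
    using pow_neighbour_pow_y[of i j] assms(2) by (subst closed_neighbours_sym) auto
  have powers: "axis \<union> cyclic_block = range (\<lambda>j :: int. x [^] j)"
    using axis_powers by (auto simp: cyclic_block_def)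
  show ?thesis unfolding powers
  proof (intro equalityI subsetI)
    fix w assume w: "w \<in> closed_neighbours G (x [^] i)"
    then have "w \<in> carrier G" by (simp add: closed_neighbours_def)
    moreover have "w \<notin> range (\<lambda>j :: int. x [^] j \<otimes> y)" using w no_y by blast
    ultimately show "w \<in> range (\<lambda>j :: int. x [^] j)" by (simp only: carrier_eq Un_iff) simp
  next
    fix w assume "w \<in> range (\<lambda>j :: int. x [^] j)"
    then show "w \<in> closed_neighbours G (x [^] i)" using pow_neighbour_pow[OF assms(1)] by blast
  qed
qed

lemma closed_neighbours_involution:
  assumes "n = 2 ^ k"
  shows "closed_neighbours G (x [^] int n) = carrier G"
proof -
  have pow_y: "x [^] j \<otimes> y \<in> closed_neighbours G (x [^] int n)" for j :: int
    using pow_neighbour_pow_y[of "int n" j] by (subst closed_neighbours_sym) (auto simp: axis_def)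
  have "closed_neighbours G (x [^] int n) \<subseteq> carrier G" by (auto simp: closed_neighbours_def)
  moreover have "carrier G \<subseteq> closed_neighbours G (x [^] int n)"
    unfolding carrier_eq by (intro Un_least image_subsetI pow_neighbour_pow[OF assms] pow_y)
  ultimately show ?thesis by (rule equalityI)
qed

text \<open>The identity is the root. The forests on the blocks with both axis elements as roots are counted
  by Cayley's formula, one factor for each block, and then the involution is turned from a root
  into an ordinary vertex.\<close>

theorem kappa_quaternion_group:
  assumes n: "n = 2 ^ k"
  shows "kappa G = 2 ^ (5 * n - 1) * n ^ (2 * n - 2)"
proof -
  let ?N = "closed_neighbours G" and ?Z = "x [^] int n"
  define Q where "Q = (\<Union>i\<in>{0..<int n}. quaternion_block i)"
  define A where "A = cyclic_block \<union> Q"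
  have N_cyc: "?N v = cyclic_block \<union> axis" if "v \<in> cyclic_block" for v
    using that closed_neighbours_pow[OF n] by (auto simp: cyclic_block_def)
  have N_Q: "?N v = quaternion_block i \<union> axis" if v: "v \<in> quaternion_block i" for i v
  proof -
    obtain j :: int where j: "v = x [^] j \<otimes> y" using v by (auto simp: quaternion_block_def)
    then have "[i = j] (mod int n)" using v by (simp add: pow_y_in_block_iff)
    then have "x [^] m \<otimes> y \<in> quaternion_block i \<longleftrightarrow> x [^] m \<otimes> y \<in> quaternion_block j" for m :: int
      by (simp add: pow_y_in_block_iff cong_def)
    moreover have "quaternion_block l \<subseteq> range (\<lambda>m :: int. x [^] m \<otimes> y)" for l
      unfolding quaternion_block_def by blast
    ultimately have "quaternion_block i = quaternion_block j" by blast
    then show ?thesis using closed_neighbours_pow_y j by auto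
  qed
  have disj: "cyclic_block \<inter> axis = {}" "cyclic_block \<inter> quaternion_block i = {}"
    "quaternion_block i \<inter> axis = {}" for i
    using quaternion_block_disjoint_powers axis_powers by (auto simp: cyclic_block_def)
  have Z1: "?Z \<noteq> \<one>" using card_axis(2) by (auto simp: axis_def)
  have finQ: "finite Q" using card_quaternion_block by (simp add: Q_def)
  have cardQ: "card Q = 2 * n"
    unfolding Q_def using card_quaternion_block quaternion_blocks_disjoint
    by (subst card_UN_disjoint) auto
  have finA: "finite A" and cardA: "card A = 4 * n - 2"
    using finQ cardQ card_cyclic_block disj n_pos by (auto simp: A_def Q_def card_Un_disjoint Int_UN_distrib)
  have A_axis: "A \<inter> axis = {}" using disj unfolding A_def Q_def by blast
  have carrier: "carrier G = insert ?Z (A \<union> {\<one>})"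
    unfolding carrier_decomp by (auto simp: A_def Q_def axis_def)

  \<comment> \<open>Cayley's formula with \<open>2 n - 2\<close> vertices and two roots; for \<open>n = 1\<close> the block is empty.\<close>
  have f_cyc: "n * card (rooted_forests cyclic_block ?N) = (2 * n) ^ (2 * n - 2)"
  proof -
    have "card cyclic_block + card axis = 2 * n" using card_cyclic_block card_axis n_pos by simp
    then have "2 * n * card (rooted_forests cyclic_block (\<lambda>_. cyclic_block \<union> axis)) = 2 * (2 * n) ^ (2 * n - 2)"
      using card_rooted_forests_complete[of cyclic_block axis] disj(1) card_axis card_cyclic_block by simp
    moreover have "rooted_forests cyclic_block ?N = rooted_forests cyclic_block (\<lambda>_. cyclic_block \<union> axis)"
      using N_cyc by (rule rooted_forests_cong)
    ultimately show ?thesis by simp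
  qed
  \<comment> \<open>Two vertices and two roots, so \<open>2 \<cdot> 4\<close> forests.\<close>
  have f_Q: "card (rooted_forests (quaternion_block i) ?N) = 8" for i
  proof -
    have "4 * card (rooted_forests (quaternion_block i) (\<lambda>_. quaternion_block i \<union> axis)) = 2 * 4 ^ 2"
      using card_rooted_forests_complete[of "quaternion_block i" axis] disj card_axis card_quaternion_block
      by simp
    moreover have "rooted_forests (quaternion_block i) ?N
        = rooted_forests (quaternion_block i) (\<lambda>_. quaternion_block i \<union> axis)"
      using N_Q by (rule rooted_forests_cong)
    ultimately show ?thesis by simp
  qed
  have "card (rooted_forests A ?N) = card (rooted_forests cyclic_block ?N) * card (rooted_forests Q ?N)"
    unfolding A_def
  proof (rule card_rooted_forests_Un)
    show "cyclic_block \<inter> Q = {}" using disj(2) unfolding Q_def by blast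
    show "?N v \<inter> Q = {}" if "v \<in> cyclic_block" for v
      using N_cyc[OF that] disj(2,3) unfolding Q_def by blast
  qed (use finQ card_cyclic_block in auto)
  also have "card (rooted_forests Q ?N) = (\<Prod>i\<in>{0..<int n}. card (rooted_forests (quaternion_block i) ?N))"
    unfolding Q_def
  proof (rule card_rooted_forests_UN)
    show "?N v \<inter> quaternion_block j = {}"
      if "i \<in> {0..<int n}" "j \<in> {0..<int n}" "i \<noteq> j" "v \<in> quaternion_block i" for i j v
      using N_Q[OF that(4)] quaternion_blocks_disjoint[OF that(1-3)] disj(3)[of j] by blast
  qed (use card_quaternion_block quaternion_blocks_disjoint in auto)
  also have "\<dots> = 8 ^ n" by (simp add: f_Q)
  finally have f_A: "card (rooted_forests A ?N) = card (rooted_forests cyclic_block ?N) * 8 ^ n" .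

  have finC: "finite (carrier G)" using finA by (simp add: carrier)
  have "kappa G = card (rooted_forests (carrier G - {\<one>}) ?N)"
    using finC by (intro kappa_eq_card_rooted_forests) auto
  also have "carrier G - {\<one>} = insert ?Z A" using A_axis Z1 by (auto simp: carrier axis_def)
  finally have "kappa G = card (rooted_forests (insert ?Z A) ?N)" .
  moreover have "2 * card (rooted_forests (insert ?Z A) ?N) = card (rooted_forests A ?N) * (4 * n)"
  proof -
    have "(card {\<one>} + 1) * card (rooted_forests (insert ?Z A) ?N)
        = card (rooted_forests A ?N) * card {\<one>} * (card A + card {\<one>} + 1)"
    proof (rule card_rooted_forests_insert)
      show "insert ?Z {\<one>} \<subseteq> ?N v" "?N v \<subseteq> insert ?Z (A \<union> {\<one>})" if "v \<in> A" for v
        using that N_cyc N_Q by (auto simp: A_def Q_def axis_def)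
      show "?N ?Z = insert ?Z (A \<union> {\<one>})"
        using closed_neighbours_involution[OF n] carrier by simp
    qed (use finA A_axis Z1 in \<open>auto simp: axis_def\<close>)
    moreover have "card A + card {\<one>} + 1 = 4 * n" using cardA n_pos by simp
    ultimately have "(card {\<one>} + 1) * card (rooted_forests (insert ?Z A) ?N)
        = card (rooted_forests A ?N) * card {\<one>} * (4 * n)" by (simp only:)
    moreover have "card {\<one>} = 1" by simp
    ultimately show ?thesis by (simp only: mult_1_right one_add_one)
  qed
  ultimately have "2 * kappa G = 2 * (2 * (n * card (rooted_forests cyclic_block ?N)) * 8 ^ n)"
    by (simp add: f_A)
  then have "kappa G = 2 * (2 * n) ^ (2 * n - 2) * 8 ^ n" by (simp only: f_cyc mult_cancel1) simp
  also have "(8 :: nat) ^ n = 2 ^ (3 * n)" by (simp add: power_mult)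
  also have "2 * (2 * n) ^ (2 * n - 2) * 2 ^ (3 * n) = 2 ^ (1 + (2 * n - 2) + 3 * n) * n ^ (2 * n - 2)"
    by (simp add: power_add power_mult_distrib)
  also have "1 + (2 * n - 2) + 3 * n = 5 * n - 1" using n_pos by simp
  finally show ?thesis .
qed

end

section \<open>The presented group\<close>

text \<open>The pair \<open>(i, b)\<close> stands for \<open>x\<^sup>i\<close> or, if \<open>b\<close> holds, for \<open>x\<^sup>i y\<close>, with \<open>i\<close> reduced modulo \<open>2 n\<close>. A
  letter acts on these normal forms as left multiplication should act in a group in which they are
  distinct, by the rules \<open>y x\<^sup>i = x\<^sup>-\<^sup>i y\<close> and \<open>y\<^sup>2 = x\<^sup>n\<close>.\<close>

fun act_letter :: "int \<Rightarrow> quat_gen \<times> bool \<Rightarrow> int \<times> bool \<Rightarrow> int \<times> bool" where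
  "act_letter n (gen_x, s) (i, b) = ((if s then i + 1 else i - 1) mod (2 * n), b)"
| "act_letter n (gen_y, s) (i, b) = ((if b = s then n - i else - i) mod (2 * n), \<not> b)"

definition act :: "int \<Rightarrow> quat_gen word \<Rightarrow> int \<times> bool \<Rightarrow> int \<times> bool" where
  "act n u = foldr (act_letter n) u"

lemma act_simps [simp]:
  "act n [] = id" "act n (l # u) = act_letter n l \<circ> act n u" "act n (u @ v) = act n u \<circ> act n v"
  by (simp_all add: act_def fun_eq_iff)

lemma act_letter_range: "0 < n \<Longrightarrow> fst (act_letter n l s) \<in> {0..<2 * n}"
  by (cases "(n, l, s)" rule: act_letter.cases) auto

lemma act_range: "0 < n \<Longrightarrow> fst s \<in> {0..<2 * n} \<Longrightarrow> fst (act n u s) \<in> {0..<2 * n}"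
  by (cases u) (use act_letter_range in auto)

lemma act_replicate_x:
  "fst s \<in> {0..<2 * n} \<Longrightarrow> act n (replicate k (gen_x, True)) s = ((fst s + int k) mod (2 * n), snd s)"
  by (cases s, induction k) (auto simp: mod_simps algebra_simps)

text \<open>The defining relations hold for this action, so it is an action of the presented group. It is
  what separates the normal forms: the relations alone cannot show that words are not equal.\<close>

lemma act_pres_eq:
  assumes "pres_eq (quaternion_relations n) u v" "0 < n" "fst s \<in> {0..<2 * int n}"
  shows "act (int n) u s = act (int n) v s"
  using assms(1,3)
proof (induction arbitrary: s rule: pres_eq.induct)
  case (relation u v)
  obtain i b where s: "s = (i, b)" "0 \<le> i" "i < 2 * int n" using relation.prems by (cases s) auto
  from relation.hyps consider
      "u = replicate (2 * n) (gen_x, True)" "v = []"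
    | "u = replicate 2 (gen_y, True)" "v = replicate n (gen_x, True)"
    | "u = [(gen_y, False), (gen_x, True), (gen_y, True)]" "v = [(gen_x, False)]"
    by (auto simp: quaternion_relations_def)
  then show ?case
  proof cases
    case 1
    then show ?thesis using relation.prems s by (simp add: act_replicate_x)
  next
    case 2
    have "(i - int n) mod (int n * 2) = (i + int n) mod (int n * 2)"
      by (simp add: mod_eq_dvd_iff)
    with 2 show ?thesis using relation.prems s
      by (auto simp: act_replicate_x numeral_2_eq_2 mod_simps algebra_simps)
  next
    case 3
    then show ?thesis using s by (auto simp: mod_simps algebra_simps)
  qed
next
  case (cancel a b)
  then show ?case by (cases s; cases a; cases b) (auto simp: mod_simps)
next
  case (append u u' v v')
  then show ?case using act_range[of "int n" s v'] assms(2) by simp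
qed simp_all

text \<open>Products of generators can be brought into normal form, which describes the carrier, and the
  images of \<open>(0, False)\<close> under the action give the order of \<open>x\<close> and separate \<open>y\<close> from the powers
  of \<open>x\<close>.\<close>

lemma quaternion_group_presented:
  assumes n: "0 < n"
  defines "R \<equiv> quaternion_relations n"
  shows "quaternion_group (generalized_quaternion n)
    (word_class R [(gen_x, True)]) (word_class R [(gen_y, True)]) n"
proof -
  define G where "G = presented_group R"
  interpret group G unfolding G_def by (rule group_presented_group)
  define x where "x = word_class R [(gen_x, True)]"
  define y where "y = word_class R [(gen_y, True)]"
  have mult: "word_class R u \<otimes>\<^bsub>G\<^esub> word_class R v = word_class R (u @ v)" for u v
    unfolding G_def by (rule mult_word_class)
  have carrier: "carrier G = range (word_class R)" and one: "\<one>\<^bsub>G\<^esub> = word_class R []"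
    by (simp_all add: G_def presented_group_def)
  have xy [simp]: "x \<in> carrier G" "y \<in> carrier G" by (simp_all add: carrier x_def y_def)
  have pow_x: "x [^]\<^bsub>G\<^esub> k = word_class R (replicate k (gen_x, True))" for k :: nat
  proof (induction k)
    case 0
    show ?case by (simp add: one)
  next
    case (Suc k)
    then show ?case by (simp add: x_def mult replicate_append_same)
  qed
  have rel: "word_class R u = word_class R v" if "(u, v) \<in> R" for u v
    using that by (simp add: word_class_eq_iff pres_eq.relation)
  have inverse: "word_class R [(a, \<not> b)] = inv\<^bsub>G\<^esub> word_class R [(a, b)]" for a b
  proof (rule inv_equality[symmetric])
    have "pres_eq R [(a, \<not> b), (a, b)] []" using pres_eq.cancel[of R a "\<not> b"] by simp
    then show "word_class R [(a, \<not> b)] \<otimes>\<^bsub>G\<^esub> word_class R [(a, b)] = \<one>\<^bsub>G\<^esub>"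
      by (simp add: mult one word_class_eq_iff)
  qed (simp_all add: carrier)
  have inv_x: "inv\<^bsub>G\<^esub> x = word_class R [(gen_x, False)]"
    and inv_y: "inv\<^bsub>G\<^esub> y = word_class R [(gen_y, False)]"
    using inverse[of gen_x True] inverse[of gen_y True] by (simp_all add: x_def y_def)
  have act_eq: "act (int n) u (0, False) = act (int n) v (0, False)"
    if "word_class R u = word_class R v" for u v
    using that n act_pres_eq[of n u v "(0, False)"] by (simp add: word_class_eq_iff R_def)

  have x_2n: "x [^]\<^bsub>G\<^esub> (2 * n) = \<one>\<^bsub>G\<^esub>"
    unfolding pow_x one by (rule rel) (simp add: R_def quaternion_relations_def)
  have y_sq: "y \<otimes>\<^bsub>G\<^esub> y = x [^]\<^bsub>G\<^esub> n"
    unfolding pow_x y_def mult by (rule rel) (simp add: R_def quaternion_relations_def numeral_2_eq_2)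
  have "inv\<^bsub>G\<^esub> y \<otimes>\<^bsub>G\<^esub> x \<otimes>\<^bsub>G\<^esub> y = inv\<^bsub>G\<^esub> x"
    unfolding inv_x inv_y unfolding x_def y_def mult
    by (rule rel) (simp add: R_def quaternion_relations_def)
  then have conj: "x \<otimes>\<^bsub>G\<^esub> y = y \<otimes>\<^bsub>G\<^esub> inv\<^bsub>G\<^esub> x"
    by (metis xy inv_closed inv_solve_left m_assoc m_closed)
  have ord: "ord x = 2 * n"
  proof (rule dvd_antisym)
    show "ord x dvd 2 * n" using x_2n by (simp add: pow_eq_id)
    have "x [^]\<^bsub>G\<^esub> ord x = \<one>\<^bsub>G\<^esub>" by simp
    then have "act (int n) (replicate (ord x) (gen_x, True)) (0, False) = act (int n) [] (0, False)"
      unfolding pow_x one by (rule act_eq)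
    then have "int (ord x) mod (2 * int n) = 0" using n by (simp add: act_replicate_x)
    then have "int (2 * n) dvd int (ord x)" by (simp add: mod_eq_0_iff_dvd)
    then show "2 * n dvd ord x" by (simp only: of_nat_dvd_iff)
  qed
  have int_pow: "\<exists>k :: nat. x [^]\<^bsub>G\<^esub> i = x [^]\<^bsub>G\<^esub> k" for i :: int
  proof -
    have "x [^]\<^bsub>G\<^esub> i = x [^]\<^bsub>G\<^esub> int (nat (i mod int (2 * n)))"
      using n by (simp add: int_pow_eq ord mod_eq_dvd_iff[symmetric] mod_simps)
    then show ?thesis unfolding int_pow_int by blast
  qed
  have y_not: "y \<noteq> x [^]\<^bsub>G\<^esub> i" for i :: int
  proof
    assume "y = x [^]\<^bsub>G\<^esub> i"
    then obtain k :: nat where "y = x [^]\<^bsub>G\<^esub> k" using int_pow by metis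
    then have "act (int n) [(gen_y, True)] (0, False) = act (int n) (replicate k (gen_x, True)) (0, False)"
      unfolding y_def pow_x by (rule act_eq)
    then show False using n by (simp add: act_replicate_x)
  qed
  \<comment> \<open>The normal forms are closed under left multiplication by the letters.\<close>
  define S where "S = range (\<lambda>i :: int. x [^]\<^bsub>G\<^esub> i) \<union> range (\<lambda>i :: int. x [^]\<^bsub>G\<^esub> i \<otimes>\<^bsub>G\<^esub> y)"
  have x_S: "x [^]\<^bsub>G\<^esub> i \<otimes>\<^bsub>G\<^esub> s \<in> S" if "s \<in> S" for i :: int and s
    using that unfolding S_def by (auto simp flip: m_assoc int_pow_mult)
  have y_S: "y \<otimes>\<^bsub>G\<^esub> s \<in> S" if s: "s \<in> S" for s
  proof -
    have comm: "y \<otimes>\<^bsub>G\<^esub> x [^]\<^bsub>G\<^esub> i = x [^]\<^bsub>G\<^esub> (- i) \<otimes>\<^bsub>G\<^esub> y" for i :: int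
      using int_pow_commute_inverting[OF xy conj, of "- i"] by simp
    have "y \<otimes>\<^bsub>G\<^esub> (x [^]\<^bsub>G\<^esub> i \<otimes>\<^bsub>G\<^esub> y) = x [^]\<^bsub>G\<^esub> (- i + int n)" for i :: int
    proof -
      have "y \<otimes>\<^bsub>G\<^esub> (x [^]\<^bsub>G\<^esub> i \<otimes>\<^bsub>G\<^esub> y) = x [^]\<^bsub>G\<^esub> (- i) \<otimes>\<^bsub>G\<^esub> y \<otimes>\<^bsub>G\<^esub> y"
        by (simp add: comm flip: m_assoc)
      also have "\<dots> = x [^]\<^bsub>G\<^esub> (- i) \<otimes>\<^bsub>G\<^esub> x [^]\<^bsub>G\<^esub> int n"
        by (simp add: m_assoc y_sq int_pow_int)
      finally show ?thesis by (simp only: int_pow_mult xy)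
    qed
    then show ?thesis using s comm unfolding S_def by auto
  qed
  have inv_y_eq: "inv\<^bsub>G\<^esub> y = x [^]\<^bsub>G\<^esub> (- int n) \<otimes>\<^bsub>G\<^esub> y"
    by (rule inv_equality) (simp_all add: m_assoc y_sq int_pow_neg int_pow_int)
  have gen_S: "word_class R [l] \<otimes>\<^bsub>G\<^esub> s \<in> S" if s: "s \<in> S" for l s
  proof -
    have [simp]: "s \<in> carrier G" using s by (auto simp: S_def)
    obtain a b where l: "l = (a, b)" by force
    show ?thesis
    proof (cases a)
      case gen_x
      then have "word_class R [l] = x [^]\<^bsub>G\<^esub> (if b then 1 else - 1 :: int)"
        by (simp add: l inv_x[symmetric] int_pow_neg flip: x_def)
      then show ?thesis using x_S[OF s] by simp
    next
      case gen_y
      then have "word_class R [l] = (if b then y else x [^]\<^bsub>G\<^esub> (- int n) \<otimes>\<^bsub>G\<^esub> y)"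
        by (simp add: l inv_y_eq[symmetric] inv_y flip: y_def)
      then show ?thesis using y_S[OF s] x_S[OF y_S[OF s]] by (simp add: m_assoc)
    qed
  qed
  have "word_class R u \<in> S" for u
  proof (induction u)
    case Nil
    have "\<one>\<^bsub>G\<^esub> = x [^]\<^bsub>G\<^esub> (0 :: int)" by simp
    then show ?case unfolding S_def one[symmetric] by blast
  next
    case (Cons l u)
    then show ?case using gen_S[of "word_class R u" l] by (simp add: mult)
  qed
  then have "carrier G \<subseteq> S" unfolding carrier by blast
  moreover have "S \<subseteq> carrier G" by (auto simp: S_def)
  ultimately have "carrier G = S" by (rule equalityI)
  have "quaternion_group G x y n"
  proof unfold_locales
    show "carrier G = range (\<lambda>i :: int. x [^]\<^bsub>G\<^esub> i) \<union> range (\<lambda>i :: int. x [^]\<^bsub>G\<^esub> i \<otimes>\<^bsub>G\<^esub> y)"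
      using \<open>carrier G = S\<close> unfolding S_def .
  qed (use n ord y_sq conj y_not in \<open>simp_all add: int_pow_int\<close>)
  then show ?thesis by (simp add: G_def x_def y_def R_def generalized_quaternion_def)
qed

theorem theorem5p2:
  fixes n :: nat
  assumes "\<exists>k::nat. n = 2 ^ k"
  shows "kappa (generalized_quaternion n) = 2 ^ (5 * n - 1) * n ^ (2 * n - 2)"
proof -
  obtain k :: nat where k: "n = 2 ^ k" using assms by blast
  then have "0 < n" by simp
  from quaternion_group.kappa_quaternion_group[OF quaternion_group_presented[OF this] k]
  show ?thesis .
qed

end
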